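(* Let $n\ge 1$ and let $\mathcal{D}$ denote Green's $\mathcal{D}$-relation on the multiplicative semigroup $(A^+(B_n),\circ)$. For $f,g\in A^+(B_n)$, $f\,\mathcal{D}\,g$ if and only if $|\mathrm{supp}(f)|=|\mathrm{supp}(g)|$ or $f,g\in\mathcal{C}_{B_n}$. Hence, for $n\ge 2$, the number of $\mathcal{D}$-classes in $(A^+(B_n),\circ)$ is $3$.
   Context: For $n\ge 1$ let $[n]=\{1,\dots,n\}$. The Brandt semigroup $(B_n,+)$ has underlying set $B_n=([n]\times[n])\cup\{\vartheta\}$ with $(i,j)+(k,l)=(i,l)$ if $j=k$, $(i,j)+(k,l)=\vartheta$ if $j\ne k$, and $\alpha+\vartheta=\vartheta+\alpha=\vartheta$ for all $\alpha\in B_n$. $M(B_n)$ is the set of all maps $B_n\to B_n$; arguments are written on the left of functions. It carries pointwise addition $\alpha(f+g)=\alpha f+\alpha g$ and composition $\alpha(f\circ g)=(\alpha f)g$ (so in $f\circ g$ the map $f$ is applied first). An affine map over $B_n$ is a map of the form $g+h$ with $g$ an endomorphism of the semigroup $(B_n,+)$ (not required to fix $\vartheta$) and $h\in M(B_n)$ a constant map. $A^+(B_n)$ (the affine near-semiring over $B_n$) is the smallest subset of $M(B_n)$ that contains all affine maps and is closed under $+$ and $\circ$. $\mathcal{C}_{B_n}$ is the set of all constant maps on $B_n$ (including the one with value $\vartheta$), and $\mathrm{supp}(f)=\{\alpha\in B_n : \alpha f\neq\vartheta\}$. *)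

theory Defs
  imports "HOL-Library.FuncSet"
begin

section \<open>The Brandt semigroup\<close>

datatype brandt_elt = Elt nat nat | Theta (\<open>\<vartheta>\<close>)

definition brandt :: "nat \<Rightarrow> brandt_elt set" where
  "brandt n = {Elt i j | i j. i \<in> {1..n} \<and> j \<in> {1..n}} \<union> {\<vartheta>}"

fun brandt_add :: "brandt_elt \<Rightarrow> brandt_elt \<Rightarrow> brandt_elt" (infixl \<open>\<oplus>\<^sub>B\<close> 65) where
  "Elt i j \<oplus>\<^sub>B Elt k l = (if j = k then Elt i l else \<vartheta>)"
| "\<vartheta> \<oplus>\<^sub>B _ = \<vartheta>"
| "_ \<oplus>\<^sub>B \<vartheta> = \<vartheta>"

section \<open>Maps on the Brandt semigroup\<close>

text \<open>
  A map from \<open>brandt n\<close> to itself is an extensional function, so that equality of functions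
  is equality of maps and maps can be counted.
\<close>

abbreviation maps :: "nat \<Rightarrow> (brandt_elt \<Rightarrow> brandt_elt) set" where
  "maps n \<equiv> brandt n \<rightarrow>\<^sub>E brandt n"

definition maps_add ::
  "nat \<Rightarrow> (brandt_elt \<Rightarrow> brandt_elt) \<Rightarrow> (brandt_elt \<Rightarrow> brandt_elt) \<Rightarrow> brandt_elt \<Rightarrow> brandt_elt" where
  "maps_add n f g = (\<lambda>\<alpha>\<in>brandt n. f \<alpha> \<oplus>\<^sub>B g \<alpha>)"

text \<open>Arguments stand on the left of maps, so the first factor of a product is applied first.\<close>

definition maps_comp ::
  "nat \<Rightarrow> (brandt_elt \<Rightarrow> brandt_elt) \<Rightarrow> (brandt_elt \<Rightarrow> brandt_elt) \<Rightarrow> brandt_elt \<Rightarrow> brandt_elt" where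
  "maps_comp n f g = (\<lambda>\<alpha>\<in>brandt n. g (f \<alpha>))"

definition const_maps :: "nat \<Rightarrow> (brandt_elt \<Rightarrow> brandt_elt) set" where
  "const_maps n = {(\<lambda>\<alpha>\<in>brandt n. c) | c. c \<in> brandt n}"

definition endos :: "nat \<Rightarrow> (brandt_elt \<Rightarrow> brandt_elt) set" where
  "endos n = {g \<in> maps n. \<forall>\<alpha>\<in>brandt n. \<forall>\<beta>\<in>brandt n. g (\<alpha> \<oplus>\<^sub>B \<beta>) = g \<alpha> \<oplus>\<^sub>B g \<beta>}"

definition affine_maps :: "nat \<Rightarrow> (brandt_elt \<Rightarrow> brandt_elt) set" where
  "affine_maps n = {maps_add n g h | g h. g \<in> endos n \<and> h \<in> const_maps n}"

inductive_set affine_nearsemiring :: "nat \<Rightarrow> (brandt_elt \<Rightarrow> brandt_elt) set" for n where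
  affine: "f \<in> affine_maps n \<Longrightarrow> f \<in> affine_nearsemiring n"
| add: "f \<in> affine_nearsemiring n \<Longrightarrow> g \<in> affine_nearsemiring n \<Longrightarrow>
    maps_add n f g \<in> affine_nearsemiring n"
| comp: "f \<in> affine_nearsemiring n \<Longrightarrow> g \<in> affine_nearsemiring n \<Longrightarrow>
    maps_comp n f g \<in> affine_nearsemiring n"

definition supp :: "nat \<Rightarrow> (brandt_elt \<Rightarrow> brandt_elt) \<Rightarrow> brandt_elt set" where
  "supp n f = {\<alpha> \<in> brandt n. f \<alpha> \<noteq> \<vartheta>}"

section \<open>Green's relations on a semigroup with carrier \<open>S\<close> and multiplication \<open>m\<close>\<close>

text \<open>
  Principal one-sided ideals are taken in the semigroup with an identity adjoined,
  hence the explicit \<open>insert a\<close>.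
\<close>

definition green_L :: "'a set \<Rightarrow> ('a \<Rightarrow> 'a \<Rightarrow> 'a) \<Rightarrow> ('a \<times> 'a) set" where
  "green_L S m = {(a, b) \<in> S \<times> S.
     insert a ((\<lambda>s. m s a) ` S) = insert b ((\<lambda>s. m s b) ` S)}"

definition green_R :: "'a set \<Rightarrow> ('a \<Rightarrow> 'a \<Rightarrow> 'a) \<Rightarrow> ('a \<times> 'a) set" where
  "green_R S m = {(a, b) \<in> S \<times> S.
     insert a ((\<lambda>s. m a s) ` S) = insert b ((\<lambda>s. m b s) ` S)}"

text \<open>Green's D-relation is the join of L and R in the lattice of equivalence relations.\<close>

definition green_D :: "'a set \<Rightarrow> ('a \<Rightarrow> 'a \<Rightarrow> 'a) \<Rightarrow> ('a \<times> 'a) set" where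
  "green_D S m = \<Inter> {r. equiv S r \<and> green_L S m \<union> green_R S m \<subseteq> r}"

lemma equiv_green_D: "equiv S (green_D S m)"
proof (rule equivI)
  have "equiv S (S \<times> S)"
    by (auto simp: equiv_def refl_on_def sym_def trans_def)
  moreover have "green_L S m \<union> green_R S m \<subseteq> S \<times> S"
    by (auto simp: green_L_def green_R_def)
  ultimately show "green_D S m \<subseteq> S \<times> S"
    unfolding green_D_def by blast
  show "refl_on S (green_D S m)"
    by (auto simp: green_D_def refl_on_def equiv_def)
  show "sym (green_D S m)"
    unfolding green_D_def sym_def equiv_def by blast
  show "trans (green_D S m)"
    unfolding green_D_def trans_def equiv_def by blast
qed

lemma affine_nearsemiring_subset: "affine_nearsemiring n \<subseteq> maps n"
proof
  have add_closed: "\<alpha> \<oplus>\<^sub>B \<beta> \<in> brandt n" if "\<alpha> \<in> brandt n" "\<beta> \<in> brandt n" for \<alpha> \<beta>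
    using that by (cases \<alpha>; cases \<beta>) (auto simp: brandt_def)
  fix f assume "f \<in> affine_nearsemiring n"
  then show "f \<in> maps n"
  proof induction
    case (affine f)
    then show ?case
      by (fastforce simp: affine_maps_def endos_def const_maps_def maps_add_def intro!: add_closed)
  next
    case (add f g)
    then show ?case by (auto simp: maps_add_def PiE_iff extensional_def intro!: add_closed)
  next
    case (comp f g)
    then show ?case by (auto simp: maps_comp_def PiE_iff extensional_def)
  qed
qed

end

theory Submission
  imports Defs
begin

text \<open>
  Apart from the constant maps, an element of \<open>A\<^sup>+(B\<^sub>n)\<close> is a row map
  \<open>(i, k) \<mapsto> (i\<sigma>, p)\<close> for \<open>i \<in> I\<close>, with value \<open>\<vartheta>\<close> elsewhere, where \<open>\<sigma>\<close> is injective on \<open>I\<close>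
  and \<open>I\<close> is either \<open>{1..n}\<close> (these come from the automorphisms of \<open>B\<^sub>n\<close>) or has at most one
  element (these come from sums). Row maps multiply like partial injections that carry a source
  column \<open>k\<close> and a target column \<open>p\<close>, so \<open>card I\<close> never increases in a product; two row maps with
  equal \<open>card I\<close> are linked by an L-step that changes \<open>(I, k)\<close> and an R-step that changes
  \<open>(\<sigma>, p)\<close>. The constant maps form an ideal that is a single R-class.
\<close>

subsection \<open>Principal ideals and the D-relation\<close>

lemma green_L_subset_D: "green_L S m \<subseteq> green_D S m"
  and green_R_subset_D: "green_R S m \<subseteq> green_D S m"
  by (auto simp: green_D_def)

text \<open>If x = u y, then v x = (v u) y for every v, so all left multiples of x are left
  multiples of y. Applied in both directions, this makes the two principal left ideals
  equal.\<close>

lemma green_L_I: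
  assumes closed: "\<And>x y. x \<in> S \<Longrightarrow> y \<in> S \<Longrightarrow> m x y \<in> S"
    and assoc: "\<And>x y z. x \<in> S \<Longrightarrow> y \<in> S \<Longrightarrow> z \<in> S \<Longrightarrow> m (m x y) z = m x (m y z)"
    and "a \<in> S" "b \<in> S" "s \<in> S" "t \<in> S" and a: "a = m s b" and b: "b = m t a"
  shows "(a, b) \<in> green_L S m"
proof -
  have "insert x ((\<lambda>s. m s x) ` S) \<subseteq> insert y ((\<lambda>s. m s y) ` S)"
    if "x = m u y" "u \<in> S" "x \<in> S" "y \<in> S" for x y u
  proof -
    have "m v x \<in> (\<lambda>s. m s y) ` S" if "v \<in> S" for v
      using assoc[of v u y] closed[of v u] that \<open>x = m u y\<close> \<open>u \<in> S\<close> \<open>y \<in> S\<close> by force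
    then show ?thesis using that by auto
  qed
  from this[OF a] this[OF b] show ?thesis
    using assms(3-6) unfolding green_L_def by blast
qed

text \<open>Dual of \<open>green_L_I\<close>, with x v = y (u v).\<close>

lemma green_R_I:
  assumes closed: "\<And>x y. x \<in> S \<Longrightarrow> y \<in> S \<Longrightarrow> m x y \<in> S"
    and assoc: "\<And>x y z. x \<in> S \<Longrightarrow> y \<in> S \<Longrightarrow> z \<in> S \<Longrightarrow> m (m x y) z = m x (m y z)"
    and "a \<in> S" "b \<in> S" "s \<in> S" "t \<in> S" and a: "a = m b s" and b: "b = m a t"
  shows "(a, b) \<in> green_R S m"
proof -
  have "insert x ((\<lambda>s. m x s) ` S) \<subseteq> insert y ((\<lambda>s. m y s) ` S)"
    if "x = m y u" "u \<in> S" "x \<in> S" "y \<in> S" for x y u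
  proof -
    have "m x v \<in> (\<lambda>s. m y s) ` S" if "v \<in> S" for v
      using assoc[of y u v] closed[of u v] that \<open>x = m y u\<close> \<open>u \<in> S\<close> \<open>y \<in> S\<close> by force
    then show ?thesis using that by auto
  qed
  from this[OF a] this[OF b] show ?thesis
    using assms(3-6) unfolding green_R_def by blast
qed

section \<open>Invariants of D and counting classes by fibres\<close>

text \<open>L- or R-related elements are equal or one-sided multiples of each other, so monotonicity
  and antisymmetry give them the same \<open>rk\<close>. Equality of \<open>rk\<close> is thus an
  equivalence on \<open>S\<close> containing L and R, and D is the least such equivalence.\<close>

lemma green_D_rank_eq:
  fixes rk :: "'a \<Rightarrow> 'b::order"
  assumes l: "\<And>x y. x \<in> S \<Longrightarrow> y \<in> S \<Longrightarrow> rk (m x y) \<le> rk x"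
    and r: "\<And>x y. x \<in> S \<Longrightarrow> y \<in> S \<Longrightarrow> rk (m x y) \<le> rk y"
    and D: "(a, b) \<in> green_D S m"
  shows "rk a = rk b"
proof -
  let ?r = "{(x, y) \<in> S \<times> S. rk x = rk y}"
  have "equiv S ?r"
    by (auto simp: equiv_def refl_on_def sym_def trans_def)
  moreover have "rk x = rk y" if "(x, y) \<in> green_L S m" for x y
  proof (rule antisym)
    have xy: "x \<in> S" "y \<in> S" "x \<in> insert y ((\<lambda>s. m s y) ` S)" "y \<in> insert x ((\<lambda>s. m s x) ` S)"
      using that by (auto simp: green_L_def)
    from xy(3) show "rk x \<le> rk y" using r xy(2) by auto
    from xy(4) show "rk y \<le> rk x" using r xy(1) by auto
  qed
  moreover have "rk x = rk y" if "(x, y) \<in> green_R S m" for x y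
  proof (rule antisym)
    have xy: "x \<in> S" "y \<in> S" "x \<in> insert y ((\<lambda>s. m y s) ` S)" "y \<in> insert x ((\<lambda>s. m x s) ` S)"
      using that by (auto simp: green_R_def)
    from xy(3) show "rk x \<le> rk y" using l xy(2) by auto
    from xy(4) show "rk y \<le> rk x" using l xy(1) by auto
  qed
  ultimately have "green_D S m \<subseteq> ?r"
    unfolding green_D_def by (intro Inter_lower) (auto simp: green_L_def green_R_def)
  then show ?thesis using D by auto
qed

text \<open>The classes of \<open>r\<close> are the fibres of \<open>f\<close> over its values on
  \<open>S\<close>; being non-empty, they differ for different values.\<close>

lemma card_quotient_eq_card_image:
  assumes "equiv S r" and r: "\<And>x y. x \<in> S \<Longrightarrow> y \<in> S \<Longrightarrow> (x, y) \<in> r \<longleftrightarrow> f x = f y"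
  shows "card (S // r) = card (f ` S)"
proof -
  have cls: "r `` {x} = {y \<in> S. f y = f x}" if "x \<in> S" for x
    using assms(1) r that by (auto simp: equiv_def)
  have "S // r = (\<lambda>v. {y \<in> S. f y = v}) ` (f ` S)"
    by (auto simp: quotient_def cls)
  moreover have "inj_on (\<lambda>v. {y \<in> S. f y = v}) (f ` S)"
    by (auto simp: inj_on_def)
  ultimately show ?thesis by (simp add: card_image)
qed

subsection \<open>Row maps\<close>

lemma Theta_in_brandt [simp]: "\<vartheta> \<in> brandt n"
  by (simp add: brandt_def)

lemma Elt_in_brandt [simp]: "Elt i j \<in> brandt n \<longleftrightarrow> i \<in> {1..n} \<and> j \<in> {1..n}"
  by (auto simp: brandt_def)

lemma brandt_add_Theta_right [simp]: "\<alpha> \<oplus>\<^sub>B \<vartheta> = \<vartheta>"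
  by (cases \<alpha>) auto

lemma brandt_add_in_brandt: "\<alpha> \<in> brandt n \<Longrightarrow> \<beta> \<in> brandt n \<Longrightarrow> \<alpha> \<oplus>\<^sub>B \<beta> \<in> brandt n"
  by (cases \<alpha>; cases \<beta>) auto

definition const_map :: "nat \<Rightarrow> brandt_elt \<Rightarrow> brandt_elt \<Rightarrow> brandt_elt" where
  "const_map n c = (\<lambda>\<alpha>\<in>brandt n. c)"

text \<open>Only the values of \<sigma> on \<open>I\<close> enter, and \<open>I = {}\<close> yields
  the zero map whatever the other parameters are.\<close>

definition row_map :: "nat \<Rightarrow> nat set \<Rightarrow> (nat \<Rightarrow> nat) \<Rightarrow> nat \<Rightarrow> nat \<Rightarrow> brandt_elt \<Rightarrow> brandt_elt" where
  "row_map n I \<sigma> k p = (\<lambda>\<alpha>\<in>brandt n.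
     case \<alpha> of Elt i j \<Rightarrow> if j = k \<and> i \<in> I then Elt (\<sigma> i) p else \<vartheta> | \<vartheta> \<Rightarrow> \<vartheta>)"

text \<open>This family is closed under images and preimages along injections
  (\<open>row_support_image\<close>, \<open>row_support_vimage\<close>), which keeps products of row
  maps and their L- and R-multipliers inside the near-semiring.\<close>

definition row_support :: "nat \<Rightarrow> nat set \<Rightarrow> bool" where
  "row_support n I \<longleftrightarrow> I \<subseteq> {1..n} \<and> (I = {1..n} \<or> card I \<le> 1)"

definition row_data :: "nat \<Rightarrow> nat set \<Rightarrow> (nat \<Rightarrow> nat) \<Rightarrow> nat \<Rightarrow> nat \<Rightarrow> bool" where
  "row_data n I \<sigma> k p \<longleftrightarrow> row_support n I \<and> inj_on \<sigma> I \<and> \<sigma> ` I \<subseteq> {1..n} \<and>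
     k \<in> {1..n} \<and> p \<in> {1..n}"

lemma row_support_subset: "row_support n I \<Longrightarrow> I \<subseteq> {1..n}"
  by (simp add: row_support_def)

lemma row_support_finite: "row_support n I \<Longrightarrow> finite I"
  using row_support_subset finite_subset by blast

lemma row_support_full [simp]: "row_support n {Suc 0..n}"
  by (simp add: row_support_def)

lemma row_support_empty [simp]: "row_support n {}"
  by (simp add: row_support_def)

lemma row_support_le_one: "I \<subseteq> {1..n} \<Longrightarrow> card I \<le> 1 \<Longrightarrow> row_support n I"
  by (simp add: row_support_def)

lemma row_support_cases:
  assumes "row_support n I"
  obtains "I = {1..n}" | "I = {}" | i where "I = {i}" "i \<in> {1..n}"
proof (cases "I = {1..n}")
  case False
  then have "card I \<le> 1" using assms by (simp add: row_support_def)
  then consider "card I = 0" | "card I = 1" by linarith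
  then show thesis
  proof cases
    case 1
    then show thesis using that(2) row_support_finite[OF assms] by simp
  next
    case 2
    then obtain i where "I = {i}" by (rule card_1_singletonE)
    then show thesis using that(3) row_support_subset[OF assms] by simp
  qed
qed (rule that(1))

text \<open>An injective self-map of the finite set \<open>{1..n}\<close> is onto, so a full
  \<open>I\<close> has a full image; the other cases have at most one element.\<close>

lemma row_support_image:
  assumes "row_support n I" "inj_on \<sigma> I" "\<sigma> ` I \<subseteq> {1..n}"
  shows "row_support n (\<sigma> ` I)"
  using assms(1)
proof (cases rule: row_support_cases)
  case 1
  then have "\<sigma> ` I = {1..n}" using assms(2,3) by (metis endo_inj_surj finite_atLeastAtMost)
  then show ?thesis by simp
next
  case (3 i)
  then show ?thesis using assms(3) by (intro row_support_le_one) simp_all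
qed simp

text \<open>A full \<open>J\<close> pulls back to all of \<open>I\<close>; a singleton
  \<open>J\<close> pulls back to at most one row because \<sigma> is injective.\<close>

lemma row_support_vimage:
  assumes "row_support n I" "row_support n J" "inj_on \<sigma> I" "\<sigma> ` I \<subseteq> {1..n}"
  shows "row_support n {i \<in> I. \<sigma> i \<in> J}"
  using assms(2)
proof (cases rule: row_support_cases)
  case 1
  then have "{i \<in> I. \<sigma> i \<in> J} = I" using assms(4) by blast
  then show ?thesis using assms(1) by simp
next
  case (3 j)
  then have "card {i \<in> I. \<sigma> i \<in> J} \<le> 1"
    using assms(3) row_support_finite[OF assms(1)] by (auto simp: card_le_Suc0_iff_eq inj_on_def)
  then show ?thesis using row_support_subset[OF assms(1)] by (intro row_support_le_one) auto
qed simp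

section \<open>Sums and composites of constant maps and row maps\<close>

lemma const_maps_eq: "const_maps n = const_map n ` brandt n"
  by (auto simp: const_maps_def const_map_def)

lemma row_map_empty: "row_map n {} \<sigma> k p = const_map n \<vartheta>"
  by (auto simp: row_map_def const_map_def fun_eq_iff split: brandt_elt.splits)

lemma row_map_cong: "I = J \<Longrightarrow> (\<And>i. i \<in> J \<Longrightarrow> \<sigma> i = \<tau> i) \<Longrightarrow> row_map n I \<sigma> k p = row_map n J \<tau> k p"
  by (auto simp: row_map_def fun_eq_iff split: brandt_elt.splits)

lemma const_map_add: "maps_add n (const_map n c) (const_map n d) = const_map n (c \<oplus>\<^sub>B d)"
  by (auto simp: maps_add_def const_map_def fun_eq_iff)

lemma Theta_add_row_map: "maps_add n (const_map n \<vartheta>) f = const_map n \<vartheta>"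
  and row_map_add_Theta: "maps_add n f (const_map n \<vartheta>) = const_map n \<vartheta>"
  by (auto simp: maps_add_def const_map_def fun_eq_iff)

text \<open>The sum (a, b) + (\<sigma> i, p) is non-zero only if \<sigma> i = b. For injective
  \<sigma> at most one row survives: this is a source of the singleton supports.\<close>

lemma const_add_row_map:
  "maps_add n (const_map n (Elt a b)) (row_map n I \<sigma> k p) = row_map n {i \<in> I. \<sigma> i = b} (\<lambda>_. a) k p"
  by (auto simp: maps_add_def const_map_def row_map_def fun_eq_iff split: brandt_elt.splits)

text \<open>All non-zero values have second coordinate \<open>p\<close>, so either every row
  survives or none does.\<close>

lemma row_map_add_const:
  "maps_add n (row_map n I \<sigma> k p) (const_map n (Elt a b)) =
    row_map n (if p = a then I else {}) \<sigma> k b"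
  by (auto simp: maps_add_def const_map_def row_map_def fun_eq_iff split: brandt_elt.splits)

text \<open>A non-zero sum needs a common source column, hence k = l. Then (\<sigma> i, p) + (\<tau>
  i, q) is non-zero only if \<tau> i = p, which again leaves at most one row when \<tau> is
  injective.\<close>

lemma row_map_add:
  "maps_add n (row_map n I \<sigma> k p) (row_map n J \<tau> l q) =
    row_map n (if k = l then {i \<in> I \<inter> J. \<tau> i = p} else {}) \<sigma> k q"
  by (auto simp: maps_add_def row_map_def fun_eq_iff split: brandt_elt.splits)

lemma comp_const_map:
  "f \<in> maps n \<Longrightarrow> c \<in> brandt n \<Longrightarrow> maps_comp n f (const_map n c) = const_map n c"
  by (auto simp: maps_comp_def const_map_def fun_eq_iff PiE_iff)

lemma const_map_comp: "maps_comp n (const_map n c) f = const_map n (f c)"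
  by (auto simp: maps_comp_def const_map_def fun_eq_iff)

lemma comp_in_const_maps:
  assumes "f \<in> maps n" "g \<in> maps n" "f \<in> const_maps n \<or> g \<in> const_maps n"
  shows "maps_comp n f g \<in> const_maps n"
proof -
  from assms(3) consider c where "c \<in> brandt n" "f = const_map n c"
    | c where "c \<in> brandt n" "g = const_map n c"
    by (auto simp: const_maps_eq)
  then show ?thesis
  proof cases
    case (1 c)
    then show ?thesis using PiE_mem[OF assms(2)] by (simp add: const_maps_eq const_map_comp)
  next
    case (2 c)
    then show ?thesis using comp_const_map[OF assms(1)] by (simp add: const_maps_eq)
  qed
qed

text \<open>The first factor writes into column \<open>p\<close> and the second reads column
  \<open>l\<close>; when these agree, the partial injections compose. \<open>row_data\<close> for
  the first factor keeps its values in \<open>brandt n\<close>, where the second factor is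
  defined.\<close>

lemma row_map_comp:
  assumes "row_data n I \<sigma> k p"
  shows "maps_comp n (row_map n I \<sigma> k p) (row_map n J \<tau> l q) =
    row_map n (if p = l then {i \<in> I. \<sigma> i \<in> J} else {}) (\<tau> \<circ> \<sigma>) k q"
  using assms by (auto simp: maps_comp_def row_map_def row_data_def fun_eq_iff split: brandt_elt.splits)

lemma maps_comp_assoc:
  assumes "f \<in> maps n"
  shows "maps_comp n (maps_comp n f g) h = maps_comp n f (maps_comp n g h)"
  using assms by (auto simp: maps_comp_def fun_eq_iff PiE_iff)

section \<open>Admissible parameters and supports of row maps\<close>

text \<open>On a set with at most one element every \<sigma> is injective, so only the range
  conditions remain.\<close>

lemma row_data_le_one:
  assumes "I \<subseteq> {1..n}" "card I \<le> 1" "\<sigma> ` I \<subseteq> {1..n}" "k \<in> {1..n}" "p \<in> {1..n}"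
  shows "row_data n I \<sigma> k p"
proof -
  have "finite I" using assms(1) finite_subset by blast
  then have "inj_on \<sigma> I" using assms(2) by (auto simp: inj_on_def card_le_Suc0_iff_eq)
  then show ?thesis using assms row_support_le_one by (simp add: row_data_def)
qed

lemma card_fibre_le_one:
  assumes "inj_on \<sigma> I" "finite I"
  shows "card {i \<in> I. \<sigma> i = b} \<le> 1"
  using assms by (auto simp: card_le_Suc0_iff_eq inj_on_def)

lemma row_data_finite: "row_data n I \<sigma> k p \<Longrightarrow> finite I"
  by (auto simp: row_data_def dest: row_support_finite)

lemma row_data_comp:
  assumes "row_data n I \<sigma> k p" "row_data n J \<tau> l q"
  shows "row_data n {i \<in> I. \<sigma> i \<in> J} (\<tau> \<circ> \<sigma>) k q"
proof -
  have "inj_on (\<tau> \<circ> \<sigma>) {i \<in> I. \<sigma> i \<in> J}"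
    using assms by (auto simp: row_data_def inj_on_def)
  then show ?thesis using assms row_support_vimage[of n I J \<sigma>] by (auto simp: row_data_def)
qed

lemma row_data_empty: "row_data n I \<sigma> k p \<Longrightarrow> row_data n J \<tau> l q \<Longrightarrow> row_data n {} \<upsilon> k q"
  by (simp add: row_data_def)

lemma supp_row_map:
  assumes "row_data n I \<sigma> k p"
  shows "supp n (row_map n I \<sigma> k p) = (\<lambda>i. Elt i k) ` I"
proof -
  have "I \<subseteq> {1..n}" "k \<in> {1..n}" using assms row_support_subset by (simp_all add: row_data_def)
  then have "\<alpha> \<in> supp n (row_map n I \<sigma> k p) \<longleftrightarrow> \<alpha> \<in> (\<lambda>i. Elt i k) ` I" for \<alpha>
    by (cases \<alpha>) (auto simp: supp_def row_map_def split: if_splits)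
  then show ?thesis by blast
qed

lemma card_supp_row_map:
  assumes "row_data n I \<sigma> k p"
  shows "card (supp n (row_map n I \<sigma> k p)) = card I"
  unfolding supp_row_map[OF assms] by (intro card_image) (auto simp: inj_on_def)

text \<open>A row map fixes \<vartheta>, so the only constant map it can equal is the zero
  map.\<close>

lemma row_map_in_const_maps_iff:
  assumes "row_data n I \<sigma> k p"
  shows "row_map n I \<sigma> k p \<in> const_maps n \<longleftrightarrow> I = {}"
proof
  assume "row_map n I \<sigma> k p \<in> const_maps n"
  then obtain c where c: "row_map n I \<sigma> k p = const_map n c" by (auto simp: const_maps_eq)
  have "c = \<vartheta>" using fun_cong[OF c, of "\<vartheta>"] by (simp add: row_map_def const_map_def)
  then have "supp n (row_map n I \<sigma> k p) = {}" by (simp add: c supp_def const_map_def)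
  then show "I = {}" by (simp add: supp_row_map[OF assms])
qed (simp add: row_map_empty const_maps_eq)

subsection \<open>The elements of the affine near-semiring\<close>

text \<open>The image of \<vartheta>, and whether some pair is sent to \<vartheta>, decide
  everything. An endomorphism that fixes \<vartheta> and kills no pair is determined by its action
  on the idempotents (i, i).\<close>

lemma endos_cases:
  assumes "g \<in> endos n"
  obtains c where "c \<in> brandt n" "g = const_map n c"
  | \<sigma> where "inj_on \<sigma> {1..n}" "\<sigma> ` {1..n} \<subseteq> {1..n}"
      "g = (\<lambda>\<alpha>\<in>brandt n. case \<alpha> of Elt i j \<Rightarrow> Elt (\<sigma> i) (\<sigma> j) | \<vartheta> \<Rightarrow> \<vartheta>)"
proof -
  have g: "g \<in> maps n"
    and hom: "\<And>\<alpha> \<beta>. \<alpha> \<in> brandt n \<Longrightarrow> \<beta> \<in> brandt n \<Longrightarrow> g (\<alpha> \<oplus>\<^sub>B \<beta>) = g \<alpha> \<oplus>\<^sub>B g \<beta>"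
    using assms by (simp_all only: endos_def mem_Collect_eq)
  have in_brandt: "g \<alpha> \<in> brandt n" if "\<alpha> \<in> brandt n" for \<alpha> using PiE_mem[OF g that] .
  have const: "g = const_map n c" if "\<And>\<alpha>. \<alpha> \<in> brandt n \<Longrightarrow> g \<alpha> = c" for c
    using g that by (auto simp: const_map_def fun_eq_iff PiE_iff extensional_def)
  show thesis
  proof (cases "g \<vartheta>")
    case (Elt a b)
    have "g \<alpha> = Elt a b" if "\<alpha> \<in> brandt n" for \<alpha>
    proof -
      \<comment> \<open>The first equation forces \<open>g \<alpha>\<close> to be (a, a), the second
        (b, b); hence a = b and \<open>g \<alpha>\<close> is (a, b).\<close>
      have "g \<alpha> \<oplus>\<^sub>B Elt a b = Elt a b" "Elt a b \<oplus>\<^sub>B g \<alpha> = Elt a b"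
        using hom[OF that Theta_in_brandt] hom[OF Theta_in_brandt that] Elt by simp_all
      then show ?thesis by (cases "g \<alpha>") (auto split: if_splits)
    qed
    then have "g = const_map n (Elt a b)" by (rule const)
    moreover have "Elt a b \<in> brandt n" using in_brandt[OF Theta_in_brandt] Elt by simp
    ultimately show thesis using that(1) by blast
  next
    case Theta
    show thesis
    proof (cases "\<exists>i\<in>{1..n}. \<exists>j\<in>{1..n}. g (Elt i j) = \<vartheta>")
      case True
      then obtain i j where ij: "i \<in> {1..n}" "j \<in> {1..n}" "g (Elt i j) = \<vartheta>" by blast
      \<comment> \<open>Every pair factors through the killed one: (k, l) = (k, i) + (i, j) + (j,
        l).\<close>
      have "g (Elt k l) = \<vartheta>" if "k \<in> {1..n}" "l \<in> {1..n}" for k l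
        using hom[of "Elt k i" "Elt i l"] hom[of "Elt i j" "Elt j l"] ij that by simp
      then have "g \<alpha> = \<vartheta>" if "\<alpha> \<in> brandt n" for \<alpha> using that Theta by (cases \<alpha>) auto
      then have "g = const_map n \<vartheta>" by (rule const)
      then show thesis using that(1) Theta_in_brandt by blast
    next
      case False
      \<comment> \<open>Idempotents go to idempotents, and the non-zero idempotents are the pairs
        (s, s).\<close>
      have "\<exists>s. s \<in> {1..n} \<and> g (Elt i i) = Elt s s" if "i \<in> {1..n}" for i
      proof -
        have "g (Elt i i) \<oplus>\<^sub>B g (Elt i i) = g (Elt i i)"
          using hom[of "Elt i i" "Elt i i", symmetric] that by simp
        then show ?thesis
          using in_brandt[of "Elt i i"] False that
          by (cases "g (Elt i i)") (auto split: if_splits)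
      qed
      then obtain \<sigma> where \<sigma>: "\<And>i. i \<in> {1..n} \<Longrightarrow> \<sigma> i \<in> {1..n} \<and> g (Elt i i) = Elt (\<sigma> i) (\<sigma> i)"
        by metis
      have "inj_on \<sigma> {1..n}"
      proof (rule inj_onI, rule ccontr)
        fix i j assume ij: "i \<in> {1..n}" "j \<in> {1..n}" "\<sigma> i = \<sigma> j" "i \<noteq> j"
        \<comment> \<open>For distinct i and j the sum (i, i) + (j, j) is \<vartheta>, whereas equal
          images would have a non-zero sum.\<close>
        then have "g \<vartheta> = Elt (\<sigma> i) (\<sigma> i)"
          using hom[of "Elt i i" "Elt j j"] \<sigma>[of i] \<sigma>[of j] by simp
        then show False using Theta by simp
      qed
      moreover have "g (Elt i j) = Elt (\<sigma> i) (\<sigma> j)" if "i \<in> {1..n}" "j \<in> {1..n}" for i j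
      proof -
        have "g (Elt i j) \<noteq> \<vartheta>" using False that by blast
        then obtain s t where st: "g (Elt i j) = Elt s t" by (cases "g (Elt i j)") simp_all
        \<comment> \<open>(i, i) and (j, j) are a left and a right identity for (i, j); their images
          pin down s and t.\<close>
        have "Elt (\<sigma> i) (\<sigma> i) \<oplus>\<^sub>B Elt s t = Elt s t"
          using hom[of "Elt i i" "Elt i j", symmetric] \<sigma>[OF that(1)] st that by simp
        moreover have "Elt s t \<oplus>\<^sub>B Elt (\<sigma> j) (\<sigma> j) = Elt s t"
          using hom[of "Elt i j" "Elt j j", symmetric] \<sigma>[OF that(2)] st that by simp
        ultimately have "\<sigma> i = s \<and> \<sigma> j = t" by (cases "\<sigma> i = s"; cases "\<sigma> j = t") simp_all
        then show ?thesis using st by simp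
      qed
      then have "g = (\<lambda>\<alpha>\<in>brandt n. case \<alpha> of Elt i j \<Rightarrow> Elt (\<sigma> i) (\<sigma> j) | \<vartheta> \<Rightarrow> \<vartheta>)"
        using g Theta by (intro ext) (simp add: PiE_iff extensional_def split: brandt_elt.split)
      ultimately show thesis using that(2) \<sigma> by blast
    qed
  qed
qed

text \<open>The sum (\<sigma> i, \<sigma> j) + (\<sigma> k, p) is non-zero exactly when \<sigma> j =
  \<sigma> k, that is, j = k. Adding the constant thus cuts the map induced by \<sigma> down to one
  source column.\<close>

lemma automorphism_add_const:
  assumes "inj_on \<sigma> {1..n}" "k \<in> {1..n}"
  shows "maps_add n (\<lambda>\<alpha>\<in>brandt n. case \<alpha> of Elt i j \<Rightarrow> Elt (\<sigma> i) (\<sigma> j) | \<vartheta> \<Rightarrow> \<vartheta>)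
      (const_map n (Elt (\<sigma> k) p)) = row_map n {1..n} \<sigma> k p"
    (is "?f = ?g")
proof
  have eq_iff: "\<sigma> j = \<sigma> k \<longleftrightarrow> j = k" if "j \<in> {1..n}" for j
    using inj_on_eq_iff[OF assms(1) that assms(2)] .
  show "?f \<alpha> = ?g \<alpha>" for \<alpha>
    by (cases \<alpha>) (simp_all add: maps_add_def const_map_def row_map_def eq_iff)
qed

section \<open>Every element is a constant map or a row map\<close>

lemma affine_nearsemiring_subset_row_maps:
  assumes "f \<in> affine_nearsemiring n"
  shows "f \<in> const_maps n \<or> (\<exists>I \<sigma> k p. row_data n I \<sigma> k p \<and> f = row_map n I \<sigma> k p)"
  using assms
proof induction
  case (affine f)
  then obtain g c where g: "g \<in> endos n" and c: "c \<in> brandt n" and f: "f = maps_add n g (const_map n c)"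
    by (auto simp: affine_maps_def const_maps_eq)
  from g show ?case
  proof (cases rule: endos_cases)
    case (1 d)
    then show ?thesis using c by (auto simp: f const_map_add const_maps_eq brandt_add_in_brandt)
  next
    case (2 \<sigma>)
    show ?thesis
    proof (cases c)
      case (Elt a b)
      then have ab: "a \<in> {1..n}" "b \<in> {1..n}" using c by auto
      \<comment> \<open>Injectivity on a finite set gives surjectivity, so \<open>a\<close> has a
        preimage \<open>k\<close>, which becomes the source column.\<close>
      moreover have "\<sigma> ` {1..n} = {1..n}" using 2 by (intro endo_inj_surj) auto
      ultimately obtain k where k: "k \<in> {1..n}" "a = \<sigma> k" by blast
      have "f = row_map n {1..n} \<sigma> k b"
        unfolding f 2(3) Elt k(2) by (rule automorphism_add_const[OF 2(1) k(1)])
      moreover have "row_data n {1..n} \<sigma> k b" using 2 k ab by (simp add: row_data_def)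
      ultimately show ?thesis by blast
    next
      case Theta
      then show ?thesis by (simp add: f row_map_add_Theta const_maps_eq)
    qed
  qed
next
  case (add f g)
  from add.IH show ?case
  proof (elim disjE exE conjE)
    assume "f \<in> const_maps n" "g \<in> const_maps n"
    then show ?thesis by (auto simp: const_maps_eq const_map_add brandt_add_in_brandt)
  next
    fix I \<sigma> k p assume "f \<in> const_maps n" and r: "row_data n I \<sigma> k p" and g: "g = row_map n I \<sigma> k p"
    then obtain c where c: "c \<in> brandt n" "f = const_map n c" by (auto simp: const_maps_eq)
    show ?thesis
    proof (cases c)
      case (Elt a b)
      have "card {i \<in> I. \<sigma> i = b} \<le> 1"
        using r row_data_finite[OF r] by (intro card_fibre_le_one) (auto simp: row_data_def)
      then have "row_data n {i \<in> I. \<sigma> i = b} (\<lambda>_. a) k p"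
        using r c(1) Elt row_support_subset[of n I] by (intro row_data_le_one) (auto simp: row_data_def)
      moreover have "maps_add n f g = row_map n {i \<in> I. \<sigma> i = b} (\<lambda>_. a) k p"
        unfolding c(2) g Elt by (rule const_add_row_map)
      ultimately show ?thesis by blast
    qed (simp add: c Theta_add_row_map const_maps_eq)
  next
    fix I \<sigma> k p assume "g \<in> const_maps n" and r: "row_data n I \<sigma> k p" and f: "f = row_map n I \<sigma> k p"
    then obtain c where c: "c \<in> brandt n" "g = const_map n c" by (auto simp: const_maps_eq)
    show ?thesis
    proof (cases c)
      case (Elt a b)
      then have "row_data n (if p = a then I else {}) \<sigma> k b"
        using r c(1) by (auto simp: row_data_def)
      moreover have "maps_add n f g = row_map n (if p = a then I else {}) \<sigma> k b"
        unfolding c(2) f Elt by (rule row_map_add_const)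
      ultimately show ?thesis by blast
    qed (simp add: c row_map_add_Theta const_maps_eq)
  next
    fix I \<sigma> k p J \<tau> l q
    assume r: "row_data n I \<sigma> k p" "row_data n J \<tau> l q"
      and f: "f = row_map n I \<sigma> k p" and g: "g = row_map n J \<tau> l q"
    let ?K = "if k = l then {i \<in> I \<inter> J. \<tau> i = p} else {}"
    \<comment> \<open>At most one common row can satisfy \<tau> i = p, which makes the sum
      admissible whatever \<open>I\<close> and \<open>J\<close> are.\<close>
    have "inj_on \<tau> (I \<inter> J)" using r(2) inj_on_Int by (auto simp: row_data_def)
    then have "card ?K \<le> 1" using card_fibre_le_one[of \<tau> "I \<inter> J"] row_data_finite[OF r(1)] by simp
    then have "row_data n ?K \<sigma> k q"
      using r row_support_subset[of n I] by (intro row_data_le_one) (auto simp: row_data_def)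
    moreover have "maps_add n f g = row_map n ?K \<sigma> k q" unfolding f g by (rule row_map_add)
    ultimately show ?thesis by blast
  qed
next
  case (comp f g)
  have fg: "f \<in> maps n" "g \<in> maps n" using comp.hyps affine_nearsemiring_subset by blast+
  show ?case
  proof (cases "f \<in> const_maps n \<or> g \<in> const_maps n")
    case True
    then show ?thesis using comp_in_const_maps[OF fg] by blast
  next
    case False
    then obtain I \<sigma> k p J \<tau> l q where r: "row_data n I \<sigma> k p" "row_data n J \<tau> l q"
      and f: "f = row_map n I \<sigma> k p" and g: "g = row_map n J \<tau> l q"
      using comp.IH by blast
    let ?K = "if p = l then {i \<in> I. \<sigma> i \<in> J} else {}"
    have "row_data n ?K (\<tau> \<circ> \<sigma>) k q" using row_data_comp[OF r] row_data_empty[OF r] by simp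
    moreover have "maps_comp n f g = row_map n ?K (\<tau> \<circ> \<sigma>) k q"
      unfolding f g by (rule row_map_comp[OF r(1)])
    ultimately show ?thesis by blast
  qed
qed

section \<open>Every constant map and every row map is an element\<close>

lemma endo_const_map: "i \<in> {1..n} \<Longrightarrow> const_map n (Elt i i) \<in> endos n"
  by (simp add: endos_def const_map_def brandt_add_in_brandt)

text \<open>The constant map with value \<open>c\<close> is affine: its endomorphism part is the
  constant (i, i), where i is the first coordinate of \<open>c\<close>, so that (i, i) is an
  idempotent left identity for \<open>c\<close>. For \<vartheta> the choice i = 1 serves.\<close>

lemma const_map_in_affine_nearsemiring:
  assumes "n \<ge> 1" "c \<in> brandt n"
  shows "const_map n c \<in> affine_nearsemiring n"
proof -
  obtain i where i: "i \<in> {1..n}" "Elt i i \<oplus>\<^sub>B c = c"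
  proof (cases c)
    case (Elt a b)
    then show thesis using assms by (intro that[of a]) auto
  next
    case Theta
    then show thesis using assms by (intro that[of 1]) auto
  qed
  then have "const_map n c = maps_add n (const_map n (Elt i i)) (const_map n c)"
    by (simp add: const_map_add)
  then have "const_map n c \<in> affine_maps n"
    using endo_const_map[OF i(1)] assms(2) by (auto simp: affine_maps_def const_maps_eq)
  then show ?thesis by (rule affine_nearsemiring.affine)
qed

text \<open>The row map is the automorphism induced by \<sigma> plus the constant (\<sigma> k,
  p).\<close>

lemma full_row_map_in_affine_nearsemiring:
  assumes "row_data n {1..n} \<sigma> k p"
  shows "row_map n {1..n} \<sigma> k p \<in> affine_nearsemiring n"
proof -
  let ?g = "\<lambda>\<alpha>\<in>brandt n. case \<alpha> of Elt i j \<Rightarrow> Elt (\<sigma> i) (\<sigma> j) | \<vartheta> \<Rightarrow> \<vartheta>"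
  have \<sigma>: "inj_on \<sigma> {1..n}" "\<sigma> ` {1..n} \<subseteq> {1..n}" "k \<in> {1..n}" "p \<in> {1..n}"
    using assms by (auto simp: row_data_def)
  \<comment> \<open>Injectivity of \<sigma> ensures that sums equal to \<vartheta> stay \<vartheta>
    after relabelling.\<close>
  have "?g (\<alpha> \<oplus>\<^sub>B \<beta>) = ?g \<alpha> \<oplus>\<^sub>B ?g \<beta>" if "\<alpha> \<in> brandt n" "\<beta> \<in> brandt n" for \<alpha> \<beta>
    using that inj_onD[OF \<sigma>(1)] by (cases \<alpha>; cases \<beta>) auto
  moreover have "?g \<in> maps n" using \<sigma>(2) by (fastforce split: brandt_elt.splits)
  ultimately have "?g \<in> endos n" unfolding endos_def by blast
  moreover have "\<sigma> k \<in> {1..n}" using \<sigma> by blast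
  then have "const_map n (Elt (\<sigma> k) p) \<in> const_maps n"
    using \<sigma>(4) unfolding const_maps_eq by (intro imageI) simp
  ultimately have "row_map n {1..n} \<sigma> k p \<in> affine_maps n"
    using automorphism_add_const[OF \<sigma>(1,3), of p] unfolding affine_maps_def by force
  then show ?thesis by (rule affine_nearsemiring.affine)
qed

lemma row_map_in_affine_nearsemiring:
  assumes r: "row_data n I \<sigma> k p"
  shows "row_map n I \<sigma> k p \<in> affine_nearsemiring n"
proof -
  have n: "n \<ge> 1" using r by (auto simp: row_data_def)
  have "row_support n I" using r by (simp add: row_data_def)
  then show ?thesis
  proof (cases rule: row_support_cases)
    case 1
    then show ?thesis using r full_row_map_in_affine_nearsemiring by simp
  next
    case 2
    then show ?thesis using n by (simp add: row_map_empty const_map_in_affine_nearsemiring)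
  next
    case (3 i)
    \<comment> \<open>Adding (\<sigma> i, i) on the left of the identity row map selects row i and
      relabels it as \<sigma> i.\<close>
    have "const_map n (Elt (\<sigma> i) i) \<in> affine_nearsemiring n"
      using r 3 n by (intro const_map_in_affine_nearsemiring) (auto simp: row_data_def)
    moreover have "row_map n {1..n} id k p \<in> affine_nearsemiring n"
      using r by (intro full_row_map_in_affine_nearsemiring) (simp add: row_data_def)
    ultimately have
      "maps_add n (const_map n (Elt (\<sigma> i) i)) (row_map n {1..n} id k p) \<in> affine_nearsemiring n"
      by (rule affine_nearsemiring.add)
    moreover have "row_map n {j \<in> {1..n}. id j = i} (\<lambda>_. \<sigma> i) k p = row_map n I \<sigma> k p"
      using 3 by (intro row_map_cong) auto
    ultimately show ?thesis by (simp add: const_add_row_map)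
  qed
qed

lemma affine_nearsemiring_eq:
  assumes "n \<ge> 1"
  shows "affine_nearsemiring n =
    const_maps n \<union> {row_map n I \<sigma> k p | I \<sigma> k p. row_data n I \<sigma> k p}"
proof -
  have "const_maps n \<subseteq> affine_nearsemiring n"
    using const_map_in_affine_nearsemiring[OF assms] by (auto simp: const_maps_eq)
  then show ?thesis
    using affine_nearsemiring_subset_row_maps row_map_in_affine_nearsemiring by blast
qed

subsection \<open>The D-classes\<close>

lemma maps_comp_assoc_affine:
  assumes "x \<in> affine_nearsemiring n"
  shows "maps_comp n (maps_comp n x y) z = maps_comp n x (maps_comp n y z)"
  using assms affine_nearsemiring_subset maps_comp_assoc by blast

lemma affine_green_L_I:
  assumes "a \<in> affine_nearsemiring n" "b \<in> affine_nearsemiring n"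
    and "s \<in> affine_nearsemiring n" "t \<in> affine_nearsemiring n"
    and "a = maps_comp n s b" "b = maps_comp n t a"
  shows "(a, b) \<in> green_L (affine_nearsemiring n) (maps_comp n)"
  by (rule green_L_I[where m = "maps_comp n", OF _ _ assms])
    (auto intro: affine_nearsemiring.comp maps_comp_assoc_affine)

lemma affine_green_R_I:
  assumes "a \<in> affine_nearsemiring n" "b \<in> affine_nearsemiring n"
    and "s \<in> affine_nearsemiring n" "t \<in> affine_nearsemiring n"
    and "a = maps_comp n b s" "b = maps_comp n a t"
  shows "(a, b) \<in> green_R (affine_nearsemiring n) (maps_comp n)"
  by (rule green_R_I[where m = "maps_comp n", OF _ _ assms])
    (auto intro: affine_nearsemiring.comp maps_comp_assoc_affine)

text \<open>The composite of two constant maps is the second one, so each is a right multiple of the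
  other.\<close>

lemma const_maps_green_D:
  assumes "n \<ge> 1" "f \<in> const_maps n" "g \<in> const_maps n"
  shows "(f, g) \<in> green_D (affine_nearsemiring n) (maps_comp n)"
proof -
  have S: "f \<in> affine_nearsemiring n" "g \<in> affine_nearsemiring n"
    using assms affine_nearsemiring_eq by blast+
  have "maps_comp n x y = y" if "x \<in> const_maps n" "y \<in> const_maps n" for x y
    using that by (auto simp: const_maps_eq const_map_comp) (simp add: const_map_def)
  then have "f = maps_comp n g f" "g = maps_comp n f g"
    using assms by simp_all
  then have "(f, g) \<in> green_R (affine_nearsemiring n) (maps_comp n)"
    by (rule affine_green_R_I[OF S S])
  then show ?thesis using green_R_subset_D by blast
qed

text \<open>Precomposing with the row map of \<rho> from column \<open>l\<close> to column
  \<open>k\<close> moves the source from (I, k) to (J, l); the row map of the inverse bijection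
  moves it back.\<close>

lemma row_map_green_L:
  assumes r: "row_data n I \<sigma> k p" and J: "row_support n J" and l: "l \<in> {1..n}" and \<rho>: "bij_betw \<rho> J I"
  shows "(row_map n J (\<sigma> \<circ> \<rho>) l p, row_map n I \<sigma> k p) \<in> green_L (affine_nearsemiring n) (maps_comp n)"
proof -
  let ?inv = "inv_into J \<rho>"
  have inv: "bij_betw ?inv I J" using \<rho> by (rule bij_betw_inv_into)
  have s: "row_data n J \<rho> l k"
    using r J l \<rho> row_support_subset[of n I] by (auto simp: row_data_def bij_betw_def)
  have t: "row_data n I ?inv k l"
    using r l inv row_support_subset[OF J] by (auto simp: row_data_def bij_betw_def)
  have a: "row_data n J (\<sigma> \<circ> \<rho>) l p"
    using r J l \<rho> comp_inj_on[of \<rho> J \<sigma>] by (auto simp: row_data_def bij_betw_def)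
  have "row_map n J (\<sigma> \<circ> \<rho>) l p = maps_comp n (row_map n J \<rho> l k) (row_map n I \<sigma> k p)"
    using \<rho> by (auto simp: row_map_comp[OF s] bij_betw_def intro!: row_map_cong)
  moreover have
    "row_map n I \<sigma> k p = maps_comp n (row_map n I ?inv k l) (row_map n J (\<sigma> \<circ> \<rho>) l p)"
    using inv bij_betw_inv_into_right[OF \<rho>]
    by (auto simp: row_map_comp[OF t] bij_betw_def intro!: row_map_cong)
  ultimately show ?thesis
    by (rule affine_green_L_I[OF a[THEN row_map_in_affine_nearsemiring]
          r[THEN row_map_in_affine_nearsemiring] s[THEN row_map_in_affine_nearsemiring]
          t[THEN row_map_in_affine_nearsemiring]])
qed

text \<open>The multiplier is \<tau> after the inverse of \<sigma>, a row map on the image of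
  \<open>I\<close>. Exchanging the two maps gives the multiplier for the way back.\<close>

lemma row_map_comp_retarget:
  assumes "row_data n I \<sigma> k p" "row_data n I \<tau> k q"
  shows "row_data n (\<sigma> ` I) (\<tau> \<circ> inv_into I \<sigma>) p q"
    and "row_map n I \<tau> k q =
      maps_comp n (row_map n I \<sigma> k p) (row_map n (\<sigma> ` I) (\<tau> \<circ> inv_into I \<sigma>) p q)"
proof -
  have \<sigma>: "inj_on \<sigma> I" "row_support n (\<sigma> ` I)"
    using assms(1) row_support_image by (simp_all add: row_data_def)
  have "inj_on (\<tau> \<circ> inv_into I \<sigma>) (\<sigma> ` I)"
    using assms \<sigma> by (auto simp: row_data_def inj_on_def)
  then show "row_data n (\<sigma> ` I) (\<tau> \<circ> inv_into I \<sigma>) p q"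
    using assms \<sigma> by (auto simp: row_data_def)
  show "row_map n I \<tau> k q =
      maps_comp n (row_map n I \<sigma> k p) (row_map n (\<sigma> ` I) (\<tau> \<circ> inv_into I \<sigma>) p q)"
  proof -
    have "{i \<in> I. \<sigma> i \<in> \<sigma> ` I} = I" by blast
    then show ?thesis
      using \<sigma>(1) by (simp add: row_map_comp[OF assms(1)] cong: row_map_cong)
  qed
qed

lemma row_map_green_R:
  assumes "row_data n I \<sigma> k p" "row_data n I \<tau> k q"
  shows "(row_map n I \<sigma> k p, row_map n I \<tau> k q) \<in> green_R (affine_nearsemiring n) (maps_comp n)"
  using affine_green_R_I[OF assms[THEN row_map_in_affine_nearsemiring]
      row_map_comp_retarget(1)[OF assms(2,1), THEN row_map_in_affine_nearsemiring]
      row_map_comp_retarget(1)[OF assms, THEN row_map_in_affine_nearsemiring]]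
    row_map_comp_retarget(2)[OF assms(2,1)] row_map_comp_retarget(2)[OF assms]
  by blast

lemma row_map_green_D:
  assumes f: "row_data n I \<sigma> k p" and g: "row_data n J \<tau> l q" and "card I = card J"
  shows "(row_map n I \<sigma> k p, row_map n J \<tau> l q) \<in> green_D (affine_nearsemiring n) (maps_comp n)"
proof -
  obtain \<rho> where \<rho>: "bij_betw \<rho> J I"
    using assms row_data_finite finite_same_card_bij by metis
  \<comment> \<open>The intermediate map has the source (J, l) of the second map and the target
    column \<open>p\<close> of the first.\<close>
  have h: "row_data n J (\<sigma> \<circ> \<rho>) l p"
    using f g \<rho> comp_inj_on[of \<rho> J \<sigma>] by (auto simp: row_data_def bij_betw_def)
  let ?D = "green_D (affine_nearsemiring n) (maps_comp n)"
  have "(row_map n J (\<sigma> \<circ> \<rho>) l p, row_map n I \<sigma> k p) \<in> ?D"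
    using row_map_green_L[OF f _ _ \<rho>] g green_L_subset_D by (auto simp: row_data_def)
  moreover have "(row_map n J (\<sigma> \<circ> \<rho>) l p, row_map n J \<tau> l q) \<in> ?D"
    using row_map_green_R[OF h g] green_R_subset_D by blast
  ultimately show ?thesis
    using equiv_green_D[of "affine_nearsemiring n" "maps_comp n"]
    unfolding equiv_def by (meson symD transD)
qed

section \<open>Rank as a complete invariant of D\<close>

text \<open>Support size alone is no invariant of D: non-zero constant maps have full support but
  are D-related to the zero map. Hence all constant maps get rank 0.\<close>

definition rank :: "nat \<Rightarrow> (brandt_elt \<Rightarrow> brandt_elt) \<Rightarrow> nat" where
  "rank n f = (if f \<in> const_maps n then 0 else card (supp n f))"

lemma rank_const_map: "f \<in> const_maps n \<Longrightarrow> rank n f = 0"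
  by (simp add: rank_def)

lemma rank_row_map: "row_data n I \<sigma> k p \<Longrightarrow> rank n (row_map n I \<sigma> k p) = card I"
  by (simp add: rank_def row_map_in_const_maps_iff card_supp_row_map)

text \<open>A non-zero product of row maps has row set
  \<open>{i \<in> I. \<sigma> i \<in> J}\<close>, a subset of \<open>I\<close> that \<sigma> embeds
  into \<open>J\<close>. A product with a constant factor is constant, of rank 0.\<close>

lemma rank_comp_le:
  assumes "n \<ge> 1" "f \<in> affine_nearsemiring n" "g \<in> affine_nearsemiring n"
  shows "rank n (maps_comp n f g) \<le> rank n f \<and> rank n (maps_comp n f g) \<le> rank n g"
proof -
  have fg: "f \<in> maps n" "g \<in> maps n" using assms affine_nearsemiring_subset by blast+
  show ?thesis
  proof (cases "f \<in> const_maps n \<or> g \<in> const_maps n")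
    case True
    then have "maps_comp n f g \<in> const_maps n"
      using comp_in_const_maps fg by blast
    then show ?thesis by (simp add: rank_const_map)
  next
    case False
    then obtain I \<sigma> k p J \<tau> l q
      where r: "row_data n I \<sigma> k p" "row_data n J \<tau> l q"
        and f: "f = row_map n I \<sigma> k p" and g: "g = row_map n J \<tau> l q"
      using assms affine_nearsemiring_eq[OF assms(1)] by auto
    let ?K = "if p = l then {i \<in> I. \<sigma> i \<in> J} else {}"
    have K: "row_data n ?K (\<tau> \<circ> \<sigma>) k q"
      using row_data_comp[OF r] row_data_empty[OF r] by simp
    have "card ?K \<le> card I" using row_data_finite[OF r(1)] by (auto intro: card_mono)
    moreover have "card ?K \<le> card J"
      using row_data_finite[OF r(2)] r(1)
      by (intro card_inj_on_le[of \<sigma>]) (auto simp: row_data_def inj_on_def)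
    ultimately show ?thesis
      unfolding f g row_map_comp[OF r(1)] by (simp only: rank_row_map[OF K] rank_row_map[OF r(1)] rank_row_map[OF r(2)])
  qed
qed

lemma green_D_iff_rank:
  assumes "n \<ge> 1" "f \<in> affine_nearsemiring n" "g \<in> affine_nearsemiring n"
  shows "(f, g) \<in> green_D (affine_nearsemiring n) (maps_comp n) \<longleftrightarrow> rank n f = rank n g"
proof
  assume "(f, g) \<in> green_D (affine_nearsemiring n) (maps_comp n)"
  then show "rank n f = rank n g"
    by (rule green_D_rank_eq[rotated 2]) (use rank_comp_le[OF assms(1)] in blast)+
next
  assume eq: "rank n f = rank n g"
  \<comment> \<open>Non-constant elements have a non-empty row set, so rank 0 characterises the
    constant maps.\<close>
  have row: "\<exists>I \<sigma> k p. row_data n I \<sigma> k p \<and> h = row_map n I \<sigma> k p \<and> card I = rank n h \<and> rank n h \<noteq> 0"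
    if h: "h \<in> affine_nearsemiring n" "h \<notin> const_maps n" for h
  proof -
    obtain I \<sigma> k p where r: "row_data n I \<sigma> k p" "h = row_map n I \<sigma> k p"
      using h affine_nearsemiring_eq[OF assms(1)] by blast
    moreover have "I \<noteq> {}" using r h row_map_in_const_maps_iff by blast
    ultimately show ?thesis using rank_row_map[OF r(1)] row_data_finite[OF r(1)] by fastforce
  qed
  show "(f, g) \<in> green_D (affine_nearsemiring n) (maps_comp n)"
  proof (cases "f \<in> const_maps n \<or> g \<in> const_maps n")
    case True
    then have "rank n f = 0" "rank n g = 0" using eq by (auto simp: rank_const_map)
    then have "f \<in> const_maps n" "g \<in> const_maps n" using row assms by blast+
    then show ?thesis using const_maps_green_D assms(1) by blast
  next
    case False
    then show ?thesis using row[of f] row[of g] assms(2,3) eq row_map_green_D by force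
  qed
qed

section \<open>Support sizes and the number of classes\<close>

lemma card_brandt: "card (brandt n) = n * n + 1"
proof -
  have "brandt n = insert \<vartheta> ((\<lambda>(i, j). Elt i j) ` ({1..n} \<times> {1..n}))"
    by (auto simp: brandt_def)
  moreover have "card ((\<lambda>(i, j). Elt i j) ` ({1..n} \<times> {1..n})) = n * n"
    by (subst card_image) (auto simp: inj_on_def)
  ultimately show ?thesis by (simp add: card_insert_if image_iff)
qed

lemma card_supp_const_map: "card (supp n (const_map n c)) = (if c = \<vartheta> then 0 else n * n + 1)"
  by (simp add: supp_def const_map_def card_brandt cong: conj_cong)

text \<open>Constant maps have support size 0 or n * n + 1, all other elements a size between 1 and
  n. These ranges are disjoint, so equal support sizes never link a constant map with a non-constant
  one.\<close>

lemma card_supp_eq_iff_rank: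
  assumes "n \<ge> 1" "f \<in> affine_nearsemiring n" "g \<in> affine_nearsemiring n"
  shows "card (supp n f) = card (supp n g) \<or> (f \<in> const_maps n \<and> g \<in> const_maps n) \<longleftrightarrow>
    rank n f = rank n g"
proof -
  have const: "card (supp n h) \<in> {0, n * n + 1}" if "h \<in> const_maps n" for h
    using that by (auto simp: const_maps_eq card_supp_const_map split: if_splits)
  have nonconst: "card (supp n h) \<notin> {0, n * n + 1}"
    if h: "h \<in> affine_nearsemiring n" "h \<notin> const_maps n" for h
  proof -
    obtain I \<sigma> k p where r: "row_data n I \<sigma> k p" "h = row_map n I \<sigma> k p"
      using h affine_nearsemiring_eq[OF assms(1)] by blast
    have "I \<noteq> {}" using r h row_map_in_const_maps_iff by blast
    moreover have "card I \<le> card {1..n}"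
      using r(1) row_support_subset by (intro card_mono) (simp_all add: row_data_def)
    moreover have "n \<le> n * n" by simp
    ultimately have "card I \<noteq> 0" "card I < n * n + 1"
      using row_data_finite[OF r(1)] by (simp, unfold card_atLeastAtMost, linarith)
    then show ?thesis using r card_supp_row_map by auto
  qed
  show ?thesis
    using const[of f] const[of g] nonconst[of f] nonconst[of g] assms(2,3)
    by (auto simp: rank_def)
qed

lemma rank_image:
  assumes "n \<ge> 1"
  shows "rank n ` affine_nearsemiring n = {0, 1, n}"
proof (intro subset_antisym subsetI)
  fix r assume "r \<in> rank n ` affine_nearsemiring n"
  then obtain f where f: "f \<in> affine_nearsemiring n" "r = rank n f" by blast
  then consider "f \<in> const_maps n"
    | I \<sigma> k p where "row_data n I \<sigma> k p" "f = row_map n I \<sigma> k p"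
    using affine_nearsemiring_eq[OF assms] by blast
  then show "r \<in> {0, 1, n}"
  proof cases
    case 1
    then show ?thesis by (simp add: f(2) rank_const_map)
  next
    case (2 I \<sigma> k p)
    then have "row_support n I" by (simp add: row_data_def)
    then have "card I \<in> {0, 1, n}"
      by (cases rule: row_support_cases) simp_all
    then show ?thesis by (simp only: f(2) 2(2) rank_row_map[OF 2(1)])
  qed
next
  fix r assume "r \<in> {0, 1, n}"
  moreover have "rank n (const_map n \<vartheta>) = 0"
    by (intro rank_const_map) (simp add: const_maps_eq)
  moreover have "const_map n \<vartheta> \<in> affine_nearsemiring n"
    using assms by (intro const_map_in_affine_nearsemiring) auto
  moreover have "card I \<in> rank n ` affine_nearsemiring n" if "row_support n I" for I
  proof -
    \<comment> \<open>The identity row map on \<open>I\<close> realises the rank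
      \<open>card I\<close>; column 1 exists since n \<ge> 1.\<close>
    have "row_data n I id 1 1"
      using assms that row_support_subset[OF that] by (simp add: row_data_def)
    then show ?thesis
      using rank_row_map row_map_in_affine_nearsemiring by (metis image_eqI)
  qed
  from this[of "{1..n}"] this[of "{1}"]
  have "n \<in> rank n ` affine_nearsemiring n" "1 \<in> rank n ` affine_nearsemiring n"
    using assms row_support_le_one[of "{1}" n] by simp_all
  ultimately show "r \<in> rank n ` affine_nearsemiring n" by force
qed

theorem theorem4p7:
  fixes n :: nat
  assumes "n \<ge> 1"
  shows "(\<forall>f \<in> affine_nearsemiring n. \<forall>g \<in> affine_nearsemiring n.
            (f, g) \<in> green_D (affine_nearsemiring n) (maps_comp n) \<longleftrightarrow>
              card (supp n f) = card (supp n g) \<or> (f \<in> const_maps n \<and> g \<in> const_maps n))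
       \<and> (n \<ge> 2 \<longrightarrow>
            card (affine_nearsemiring n // green_D (affine_nearsemiring n) (maps_comp n)) = 3)"
proof (intro conjI ballI impI)
  fix f g assume "f \<in> affine_nearsemiring n" "g \<in> affine_nearsemiring n"
  then show "(f, g) \<in> green_D (affine_nearsemiring n) (maps_comp n) \<longleftrightarrow>
      card (supp n f) = card (supp n g) \<or> (f \<in> const_maps n \<and> g \<in> const_maps n)"
    using green_D_iff_rank[OF assms] card_supp_eq_iff_rank[OF assms] by simp
next
  assume "n \<ge> 2"
  \<comment> \<open>This is where n \<ge> 2 enters: for n = 1 the ranks 1 and n coincide.\<close>
  then have "card {0, 1, n} = 3" by simp
  then show "card (affine_nearsemiring n // green_D (affine_nearsemiring n) (maps_comp n)) = 3"
    using card_quotient_eq_card_image[OF equiv_green_D green_D_iff_rank[OF assms]]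
    by (simp add: rank_image[OF assms])
qed

end
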